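(* Let $M_n$ ($n\ge 0$) denote the $n$-th Motzkin number. Then: (a) the sequence $(M_n)_{n\ge 0}$ is log-convex; (b) $M_n/M_{n-1} < 3$ for all $n\ge 1$; (c) the sequence $(M_n/M_{n-1})_{n\ge 1}$ is convergent and $\lim_{n\to\infty} M_n/M_{n-1} = 3$.
   Context: A Motzkin path of length $n$ is a lattice path in the plane from $(0,0)$ to $(n,0)$ with steps $(1,1)$, $(1,-1)$ and $(1,0)$ that never falls below the $x$-axis. For $n\ge1$ the Motzkin number $M_n$ is the number of Motzkin paths of length $n$, and $M_0=1$. A sequence $(a(n))_{n\ge 0}$ of positive real numbers is log-convex if $a(n)^2\le a(n-1)a(n+1)$ for all $n\ge 1$. *)

theory Defs
  imports Complex_Main "HOL-Library.Product_Plus"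
begin

text \<open>A lattice path starting at the origin is represented by its list of steps, so that the
  vertices of \<open>p\<close> are the partial sums \<open>sum_list (take k p)\<close> for \<open>k \<le> length p\<close>.  The path is
  piecewise linear between its vertices, hence it stays weakly above the x-axis iff all its
  vertices do.\<close>

definition motzkin_steps :: "(int \<times> int) set" where
  "motzkin_steps = {(1, 1), (1, -1), (1, 0)}"

definition motzkin_path :: "nat \<Rightarrow> (int \<times> int) list \<Rightarrow> bool" where
  "motzkin_path n p \<longleftrightarrow>
     set p \<subseteq> motzkin_steps \<and>
     sum_list p = (int n, 0) \<and>
     (\<forall>k\<le>length p. 0 \<le> snd (sum_list (take k p)))"

definition motzkin :: "nat \<Rightarrow> nat" where
  "motzkin n = card {p. motzkin_path n p}"

definition log_convex :: "(nat \<Rightarrow> real) \<Rightarrow> bool" where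
  "log_convex a \<longleftrightarrow> (\<forall>n. 0 < a n) \<and> (\<forall>n\<ge>1. (a n)\<^sup>2 \<le> a (n - 1) * a (n + 1))"

lemma fst_sum_list_motzkin_steps:
  "set p \<subseteq> motzkin_steps \<Longrightarrow> fst (sum_list p) = int (length p)"
  by (induction p) (auto simp: motzkin_steps_def)

lemma length_motzkin_path: "motzkin_path n p \<Longrightarrow> length p = n"
  using fst_sum_list_motzkin_steps[of p] by (simp add: motzkin_path_def)

lemma finite_motzkin_paths: "finite {p. motzkin_path n p}"
proof (rule finite_subset)
  show "{p. motzkin_path n p} \<subseteq> {p. set p \<subseteq> motzkin_steps \<and> length p = n}"
    using length_motzkin_path by (auto simp: motzkin_path_def)
  show "finite {p. set p \<subseteq> motzkin_steps \<and> length p = n}"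
    by (rule finite_lists_length_eq) (simp add: motzkin_steps_def)
qed

text \<open>The convention \<open>M\<^sub>0 = 1\<close> agrees with counting the empty path.\<close>

lemma motzkin_0: "motzkin 0 = 1"
proof -
  have "{p. motzkin_path 0 p} = {[]}"
    using length_motzkin_path[of 0] by (auto simp: motzkin_path_def zero_prod_def)
  then show ?thesis by (simp add: motzkin_def)
qed

end

theory Submission
  imports Defs "HOL-Real_Asymp.Real_Asymp"
begin

text \<open>By reflection, the number of Motzkin prefixes of length \<open>n\<close> ending at height \<open>k\<close> is
  \<open>t(n,k) - t(n,k+2)\<close>, where \<open>t(n,j)\<close> is the coefficient of \<open>x\<^sup>j\<close> in \<open>(x + 1 + 1/x)\<^sup>n\<close>.
  The first-order differential equation of that Laurent polynomial gives a linear relation between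
  neighbouring \<open>t(n,j)\<close>, hence
  \<open>(n+4) M\<^sub>n\<^sub>+\<^sub>2 = (2n+5) M\<^sub>n\<^sub>+\<^sub>1 + 3(n+1) M\<^sub>n\<close>.
  The ratios \<open>r\<^sub>n = M\<^sub>n\<^sub>+\<^sub>1/M\<^sub>n\<close> therefore satisfy \<open>r\<^sub>n\<^sub>+\<^sub>1 = f\<^sub>n(r\<^sub>n)\<close> with \<open>f\<^sub>n\<close> decreasing, and
  \<open>3 - 9/(2n+4) \<le> r\<^sub>n \<le> 3 - 9/(2n+7)\<close> follows by induction; the upper bound lies below the
  fixed point of \<open>f\<^sub>n\<close>, so that \<open>r\<^sub>n \<le> r\<^sub>n\<^sub>+\<^sub>1\<close>.\<close>

section \<open>Trinomial coefficients\<close>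

primrec trinomial :: "nat \<Rightarrow> int \<Rightarrow> int" where
  "trinomial 0 j = (if j = 0 then 1 else 0)"
| "trinomial (Suc n) j = trinomial n (j - 1) + trinomial n j + trinomial n (j + 1)"

lemma trinomial_minus: "trinomial n (- j) = trinomial n j"
proof (induction n arbitrary: j)
  case (Suc n)
  from Suc[of "j - 1"] Suc[of j] Suc[of "j + 1"] show ?case by simp
qed simp

text \<open>The coefficient of \<open>x\<^sup>j\<close> in \<open>(x + 1 + 1/x) x P' = n (x - 1/x) P\<close> for
  \<open>P = (x + 1 + 1/x)\<^sup>n\<close>.\<close>

lemma trinomial_relation:
  "(int n + j + 1) * trinomial n (j + 1) + j * trinomial n j
    = (int n - j + 1) * trinomial n (j - 1)"
proof (induction n arbitrary: j)
  case (Suc n)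
  from Suc[of "j - 1"] Suc[of j] Suc[of "j + 1"] show ?case
    by (simp add: algebra_simps)
qed auto

section \<open>The reflection principle\<close>

definition motzkin_prefixes :: "nat \<Rightarrow> int \<Rightarrow> (int \<times> int) list set" where
  "motzkin_prefixes n k = {p. length p = n \<and> set p \<subseteq> motzkin_steps \<and> snd (sum_list p) = k \<and>
     (\<forall>i\<le>length p. 0 \<le> snd (sum_list (take i p)))}"

lemma motzkin_eq_card_prefixes: "motzkin n = card (motzkin_prefixes n 0)"
proof -
  have "{p. motzkin_path n p} = motzkin_prefixes n 0"
    using length_motzkin_path fst_sum_list_motzkin_steps
    by (auto simp: motzkin_path_def motzkin_prefixes_def prod_eq_iff)
  then show ?thesis by (simp add: motzkin_def)
qed

lemma finite_motzkin_prefixes: "finite (motzkin_prefixes n k)"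
  by (rule finite_subset[OF _ finite_lists_length_eq[of motzkin_steps n]])
    (auto simp: motzkin_prefixes_def motzkin_steps_def)

lemma motzkin_prefixes_neg: "k < 0 \<Longrightarrow> motzkin_prefixes n k = {}"
  by (force simp: motzkin_prefixes_def)

text \<open>The appended step adds one vertex, of height \<open>k\<close>, so
  \<open>0 \<le> k\<close> covers its positivity condition.\<close>

lemma snoc_in_motzkin_prefixes:
  assumes "0 \<le> k"
  shows "q @ [s] \<in> motzkin_prefixes (Suc n) k \<longleftrightarrow>
    s \<in> motzkin_steps \<and> q \<in> motzkin_prefixes n (k - snd s)"
  using assms by (auto simp: motzkin_prefixes_def le_Suc_eq)

lemma motzkin_prefixes_Suc:
  assumes "0 \<le> k"
  shows "motzkin_prefixes (Suc n) k =
    (\<Union>s\<in>motzkin_steps. (\<lambda>q. q @ [s]) ` motzkin_prefixes n (k - snd s))" (is "_ = ?R")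
proof (intro equalityI subsetI)
  fix p assume p: "p \<in> motzkin_prefixes (Suc n) k"
  then have "length p = Suc n" by (simp add: motzkin_prefixes_def)
  then obtain q s where "p = q @ [s]" by (metis length_Suc_conv_rev)
  with p show "p \<in> ?R" using snoc_in_motzkin_prefixes[OF assms] by auto
qed (use snoc_in_motzkin_prefixes[OF assms] in auto)

lemma card_motzkin_prefixes_Suc:
  assumes "0 \<le> k"
  shows "card (motzkin_prefixes (Suc n) k) =
    card (motzkin_prefixes n (k - 1)) + card (motzkin_prefixes n k)
      + card (motzkin_prefixes n (k + 1))"
proof -
  have "card (motzkin_prefixes (Suc n) k) =
      (\<Sum>s\<in>motzkin_steps. card ((\<lambda>q. q @ [s]) ` motzkin_prefixes n (k - snd s)))"
    unfolding motzkin_prefixes_Suc[OF assms]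
    by (rule card_UN_disjoint) (auto simp: motzkin_steps_def finite_motzkin_prefixes)
  also have "\<dots> = (\<Sum>s\<in>motzkin_steps. card (motzkin_prefixes n (k - snd s)))"
    by (intro sum.cong refl card_image) (auto simp: inj_on_def)
  finally show ?thesis by (simp add: motzkin_steps_def)
qed

text \<open>Both sides obey the same recursion in \<open>n\<close>. Including \<open>k = - 1\<close>
  supplies the lower neighbour of \<open>k = 0\<close>; there both sides vanish, the right one
  because \<open>trinomial n\<close> is even.\<close>

lemma card_motzkin_prefixes:
  "- 1 \<le> k \<Longrightarrow> int (card (motzkin_prefixes n k)) = trinomial n k - trinomial n (k + 2)"
proof (induction n arbitrary: k)
  case 0
  have "motzkin_prefixes 0 k = (if k = 0 then {[]} else {})"
    by (auto simp: motzkin_prefixes_def)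
  with 0 show ?case by simp
next
  case (Suc n)
  show ?case
  proof (cases "k = - 1")
    case True
    then show ?thesis
      using trinomial_minus[of "Suc n" 1] by (simp add: motzkin_prefixes_neg)
  next
    case False
    with Suc.prems have "0 \<le> k" by simp
    with Suc.IH[of "k - 1"] Suc.IH[of k] Suc.IH[of "k + 1"] show ?thesis
      by (simp add: card_motzkin_prefixes_Suc algebra_simps)
  qed
qed

section \<open>The three-term recurrence\<close>

lemma motzkin_trinomial: "int (motzkin n) = trinomial n 0 - trinomial n 2"
  using card_motzkin_prefixes[of 0 n] by (simp add: motzkin_eq_card_prefixes)

lemma motzkin_recurrence_int:
  "(int n + 4) * int (motzkin (Suc (Suc n)))
    = (2 * int n + 5) * int (motzkin (Suc n)) + 3 * (int n + 1) * int (motzkin n)"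
proof -
  define t where "t = trinomial n"
  have sym: "trinomial n (- 1) = t 1" "trinomial n (- 2) = t 2"
    by (simp_all add: t_def trinomial_minus)
  have m0: "int (motzkin n) = t 0 - t 2"
    by (simp add: motzkin_trinomial t_def)
  have m1: "int (motzkin (Suc n)) = t 0 + t 1 - t 2 - t 3"
    using sym by (simp add: motzkin_trinomial t_def)
  have m2: "int (motzkin (Suc (Suc n))) = 2 * t 0 + 2 * t 1 - t 2 - 2 * t 3 - t 4"
    using sym by (simp add: motzkin_trinomial t_def)
  \<comment> \<open>These are the relations for \<open>j = 1\<close> and \<open>j = 3\<close>; three
    times the first minus the second is the recurrence.\<close>
  have "(int n + 2) * t 2 + t 1 - int n * t 0 = 0"
    "(int n + 4) * t 4 + 3 * t 3 - (int n - 2) * t 2 = 0"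
    using trinomial_relation[of n 1] trinomial_relation[of n 3]
    by (simp_all add: t_def algebra_simps)
  moreover have "(int n + 4) * int (motzkin (Suc (Suc n)))
      - ((2 * int n + 5) * int (motzkin (Suc n)) + 3 * (int n + 1) * int (motzkin n))
    = 3 * ((int n + 2) * t 2 + t 1 - int n * t 0)
      - ((int n + 4) * t 4 + 3 * t 3 - (int n - 2) * t 2)"
    unfolding m0 m1 m2 by (simp add: algebra_simps)
  ultimately show ?thesis by simp
qed

lemma motzkin_recurrence:
  "(real n + 4) * real (motzkin (Suc (Suc n)))
    = (2 * real n + 5) * real (motzkin (Suc n)) + 3 * (real n + 1) * real (motzkin n)"
  using arg_cong[OF motzkin_recurrence_int[of n], of real_of_int] by simp

lemma motzkin_1: "motzkin (Suc 0) = 1"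
  using motzkin_trinomial[of "Suc 0"] by simp

lemma motzkin_pos: "0 < motzkin n"
proof (induction n rule: less_induct)
  case (less n)
  consider "n = 0" | "n = Suc 0" | m where "n = Suc (Suc m)"
    by (metis not0_implies_Suc)
  then show ?case
  proof cases
    case 3
    with less[of m] less[of "Suc m"] have "0 < (real m + 4) * real (motzkin n)"
      by (simp add: motzkin_recurrence add_pos_pos)
    then show ?thesis by (simp add: zero_less_mult_iff)
  qed (simp_all add: motzkin_0 motzkin_1)
qed

section \<open>Bounds for the ratios\<close>

text \<open>Here and below \<open>x\<close>, \<open>y\<close>, \<open>z\<close> stand for
  consecutive Motzkin numbers. For positive values \<open>z / y\<close> decreases in
  \<open>y / x\<close>, so an upper bound on one ratio bounds the next from below.\<close>

lemma ratio_lower_step: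
  fixes n x y z :: real
  assumes "0 \<le> n" "0 \<le> y" and rec: "(n + 4) * z = (2 * n + 5) * y + 3 * (n + 1) * x"
    and upper: "(2 * n + 7) * y \<le> (6 * n + 12) * x"
  shows "(6 * n + 9) * y \<le> (2 * n + 6) * z"
proof -
  have "(n + 4) * (2 * n + 4) * ((2 * n + 6) * z - (6 * n + 9) * y)
    = (2 * n + 4) * ((2 * n + 6) * ((n + 4) * z) - (n + 4) * (6 * n + 9) * y)"
    by (simp add: algebra_simps)
  also have "\<dots> = (2 * n + 6) * (n + 1) * ((6 * n + 12) * x - (2 * n + 7) * y) + 6 * (2 * n + 3) * y"
    unfolding rec by (simp add: algebra_simps power2_eq_square)
  also have "\<dots> \<ge> 0"
    using assms by (intro add_nonneg_nonneg mult_nonneg_nonneg) auto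
  finally show ?thesis
    using \<open>0 \<le> n\<close> by (auto simp: zero_le_mult_iff mult_le_0_iff)
qed

text \<open>The same monotonicity in the other direction; \<open>2 \<le> n\<close> makes the surplus
  \<open>(6 * n - 9) * y\<close> nonnegative.\<close>

lemma ratio_upper_step:
  fixes n x y z :: real
  assumes "2 \<le> n" "0 \<le> y" and rec: "(n + 4) * z = (2 * n + 5) * y + 3 * (n + 1) * x"
    and lower: "(6 * n + 3) * x \<le> (2 * n + 4) * y"
  shows "(2 * n + 9) * z \<le> (6 * n + 18) * y"
proof -
  have "(n + 4) * (2 * n + 1) * ((6 * n + 18) * y - (2 * n + 9) * z)
    = (2 * n + 1) * ((n + 4) * (6 * n + 18) * y - (2 * n + 9) * ((n + 4) * z))"
    by (simp add: algebra_simps)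
  also have "\<dots> = (2 * n + 9) * (n + 1) * ((2 * n + 4) * y - (6 * n + 3) * x) + (6 * n - 9) * y"
    unfolding rec by (simp add: algebra_simps power2_eq_square)
  also have "\<dots> \<ge> 0"
    using assms by (intro add_nonneg_nonneg mult_nonneg_nonneg) auto
  finally show ?thesis
    using \<open>2 \<le> n\<close> by (auto simp: zero_le_mult_iff mult_le_0_iff)
qed

lemma ratio_increasing_step:
  fixes n x y z :: real
  assumes "1 \<le> n" "0 \<le> x" "0 \<le> y" and rec: "(n + 4) * z = (2 * n + 5) * y + 3 * (n + 1) * x"
    and upper: "(2 * n + 7) * y \<le> (6 * n + 12) * x"
  shows "y\<^sup>2 \<le> x * z"
proof -
  have "(n + 4) * (2 * n + 7)\<^sup>2 * (x * z - y\<^sup>2)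
    = (2 * n + 7)\<^sup>2 * (x * ((n + 4) * z) - (n + 4) * y\<^sup>2)"
    by (simp add: algebra_simps)
  \<comment> \<open>Division of a quadratic form in \<open>x\<close> and \<open>y\<close> by the
    linear factor from \<open>upper\<close>, with remainder
    \<open>9 * (n - 1) * x\<^sup>2\<close>.\<close>
  also have "\<dots> = ((6 * n + 12) * x - (2 * n + 7) * y) *
        ((n + 4) * (2 * n + 7) * y + (2 * n\<^sup>2 + 12 * n + 13) * x) + 9 * (n - 1) * x\<^sup>2"
    unfolding rec by (simp add: algebra_simps power2_eq_square)
  also have "\<dots> \<ge> 0"
    using assms by (intro add_nonneg_nonneg mult_nonneg_nonneg) auto
  finally show ?thesis
    using \<open>1 \<le> n\<close> by (auto simp: zero_le_mult_iff mult_le_0_iff)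
qed

text \<open>The bounds are proved jointly because each one at \<open>n\<close> feeds the other at
  \<open>Suc n\<close>.\<close>

lemma motzkin_ratio_bounds:
  "(6 * real n + 3) * real (motzkin n) \<le> (2 * real n + 4) * real (motzkin (Suc n)) \<and>
   (2 * real n + 7) * real (motzkin (Suc n)) \<le> (6 * real n + 12) * real (motzkin n)"
proof (induction n)
  case 0
  show ?case by (simp add: motzkin_0 motzkin_1)
next
  case (Suc n)
  have lower: "(6 * real n + 9) * real (motzkin (Suc n))
      \<le> (2 * real n + 6) * real (motzkin (Suc (Suc n)))"
    using ratio_lower_step[OF _ _ motzkin_recurrence] Suc by simp
  have m2: "motzkin (Suc (Suc 0)) = 2"
    using motzkin_recurrence_int[of 0] by (simp add: motzkin_0 motzkin_1)
  have m3: "motzkin (Suc (Suc (Suc 0))) = 4"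
    using motzkin_recurrence_int[of 1] by (simp add: m2 motzkin_1)
  \<comment> \<open>The two cases outside \<open>ratio_upper_step\<close> follow from explicit
    values, with equality for \<open>n = 0\<close>.\<close>
  consider "n = 0" | "n = Suc 0" | "2 \<le> n" by linarith
  then have "(2 * real n + 9) * real (motzkin (Suc (Suc n)))
      \<le> (6 * real n + 18) * real (motzkin (Suc n))"
  proof cases
    case 3
    then show ?thesis
      using ratio_upper_step[OF _ _ motzkin_recurrence] Suc by simp
  qed (simp_all add: motzkin_1 m2 m3)
  with lower show ?case by (simp add: algebra_simps)
qed

lemma log_convex_motzkin: "log_convex (\<lambda>n. real (motzkin n))"
  unfolding log_convex_def
proof (intro conjI allI impI)
  fix n :: nat
  show "0 < real (motzkin n)" by (simp add: motzkin_pos)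
  assume "1 \<le> n"
  then obtain m where n: "n = Suc m" by (cases n) auto
  show "(real (motzkin n))\<^sup>2 \<le> real (motzkin (n - 1)) * real (motzkin (n + 1))"
  proof (cases "m = 0")
    \<comment> \<open>Outside the range of \<open>ratio_increasing_step\<close>: here the first two
      Motzkin numbers are 1 and the third is positive.\<close>
    case True
    with motzkin_pos[of "Suc n"] show ?thesis by (simp add: n motzkin_0 motzkin_1)
  next
    case False
    then show ?thesis
      using ratio_increasing_step[OF _ _ _ motzkin_recurrence[of m]] motzkin_ratio_bounds[of m]
      by (simp add: n)
  qed
qed

lemma motzkin_ratio_lower:
  "3 - 9 / (2 * real n + 4) \<le> real (motzkin (Suc n)) / real (motzkin n)"
  using motzkin_ratio_bounds[of n] motzkin_pos[of n] by (simp add: field_simps)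

lemma motzkin_ratio_upper:
  "real (motzkin (Suc n)) / real (motzkin n) \<le> 3 - 9 / (2 * real n + 7)"
  using motzkin_ratio_bounds[of n] motzkin_pos[of n] by (simp add: field_simps)

lemma motzkin_ratio_less_3: "real (motzkin (Suc n)) / real (motzkin n) < 3"
proof -
  have "0 < 9 / (2 * real n + 7)" by simp
  with motzkin_ratio_upper[of n] show ?thesis by linarith
qed

theorem theorem3p3:
  shows "log_convex (\<lambda>n. real (motzkin n)) \<and>
    (\<forall>n\<ge>1. real (motzkin n) / real (motzkin (n - 1)) < 3) \<and>
    (\<lambda>n. real (motzkin (Suc n)) / real (motzkin n)) \<longlonglongrightarrow> 3"
proof (intro conjI allI impI)
  show "log_convex (\<lambda>n. real (motzkin n))" by (rule log_convex_motzkin)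
  show "real (motzkin n) / real (motzkin (n - 1)) < 3" if "1 \<le> n" for n
    using that motzkin_ratio_less_3[of "n - 1"] by simp
  have "(\<lambda>n. 3 - 9 / (2 * real n + 4)) \<longlonglongrightarrow> 3" by real_asymp
  \<comment> \<open>The upper function of the sandwich is the constant 3.\<close>
  from this tendsto_const
  show "(\<lambda>n. real (motzkin (Suc n)) / real (motzkin n)) \<longlonglongrightarrow> 3"
    by (rule real_tendsto_sandwich[rotated 2])
      (intro always_eventually allI motzkin_ratio_lower less_imp_le[OF motzkin_ratio_less_3])+
qed

end
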